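(* There is a constant $c\in\mathbb{N}$ such that there are infinitely many $n\in\mathbb{N}$ satisfying \[ \mathrm{DN}(\mathrm{MSO}[n])\ge \mathrm{twr}\bigl(\sqrt{n/c}\bigr). \]
   Context: Words are nonempty finite words over $\Sigma=\{l,r\}$, identified with word models (positions with linear order $<$ and unary predicates $P_l,P_r$). MSO formulas are over $\{<,P_l,P_r\}$. Size: $\mathrm{sz}(\phi)=1$ for atomic $\phi$; $\mathrm{sz}(\psi\wedge\theta)=\mathrm{sz}(\psi\vee\theta)=\mathrm{sz}(\psi)+\mathrm{sz}(\theta)+1$; $\mathrm{sz}(\neg\psi)$ and $\mathrm{sz}$ of $\exists x\psi,\forall x\psi,\exists U\psi,\forall U\psi$ equal $\mathrm{sz}(\psi)+1$. $\mathrm{MSO}[n]$ is the set of MSO formulas of size at most $n$. A sentence $\phi$ defines a word $w$ if $w$ is the only word satisfying $\phi$; $\mathrm{Def}(L)$ is the set of words defined by some sentence of $L$, and $\mathrm{DN}(L)=\max\{|w|: w\in\mathrm{Def}(L)\}$. $\mathrm{tower}(0)=1$, $\mathrm{tower}(n+1)=2^{\mathrm{tower}(n)}$; for real $x\ge0$, $\mathrm{twr}(x)=\mathrm{tower}(\lceil x\rceil)$. *)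

theory Defs
  imports Complex_Main
begin

datatype letter = L | R

text \<open>
  Words are letter lists. The empty list is not a word here, and it is excluded wherever
  we range over words. The positions of \<^term>\<open>w :: letter list\<close> are the numbers below
  \<^term>\<open>length w\<close>.
\<close>

type_synonym word = "letter list"

text \<open>
  First-order and set variables are both named by natural numbers, but they form two
  separate name spaces. As usual, equality belongs to the logic.
\<close>

datatype mso =
    Less nat nat
  | Eq nat nat
  | Lab letter nat
  | Mem nat nat  \<comment> \<open>\<open>Mem U x\<close> is the atomic formula \<open>U(x)\<close>\<close>
  | Neg mso
  | Conj mso mso
  | Disj mso mso
  | Ex1 nat mso
  | All1 nat mso
  | Ex2 nat mso
  | All2 nat mso

primrec sz :: "mso \<Rightarrow> nat" where
  "sz (Less x y) = 1"
| "sz (Eq x y) = 1"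
| "sz (Lab a x) = 1"
| "sz (Mem U x) = 1"
| "sz (Neg \<psi>) = sz \<psi> + 1"
| "sz (Conj \<psi> \<theta>) = sz \<psi> + sz \<theta> + 1"
| "sz (Disj \<psi> \<theta>) = sz \<psi> + sz \<theta> + 1"
| "sz (Ex1 x \<psi>) = sz \<psi> + 1"
| "sz (All1 x \<psi>) = sz \<psi> + 1"
| "sz (Ex2 U \<psi>) = sz \<psi> + 1"
| "sz (All2 U \<psi>) = sz \<psi> + 1"

primrec free1 :: "mso \<Rightarrow> nat set" where
  "free1 (Less x y) = {x, y}"
| "free1 (Eq x y) = {x, y}"
| "free1 (Lab a x) = {x}"
| "free1 (Mem U x) = {x}"
| "free1 (Neg \<psi>) = free1 \<psi>"
| "free1 (Conj \<psi> \<theta>) = free1 \<psi> \<union> free1 \<theta>"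
| "free1 (Disj \<psi> \<theta>) = free1 \<psi> \<union> free1 \<theta>"
| "free1 (Ex1 x \<psi>) = free1 \<psi> - {x}"
| "free1 (All1 x \<psi>) = free1 \<psi> - {x}"
| "free1 (Ex2 U \<psi>) = free1 \<psi>"
| "free1 (All2 U \<psi>) = free1 \<psi>"

primrec free2 :: "mso \<Rightarrow> nat set" where
  "free2 (Less x y) = {}"
| "free2 (Eq x y) = {}"
| "free2 (Lab a x) = {}"
| "free2 (Mem U x) = {U}"
| "free2 (Neg \<psi>) = free2 \<psi>"
| "free2 (Conj \<psi> \<theta>) = free2 \<psi> \<union> free2 \<theta>"
| "free2 (Disj \<psi> \<theta>) = free2 \<psi> \<union> free2 \<theta>"
| "free2 (Ex1 x \<psi>) = free2 \<psi>"
| "free2 (All1 x \<psi>) = free2 \<psi>"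
| "free2 (Ex2 U \<psi>) = free2 \<psi> - {U}"
| "free2 (All2 U \<psi>) = free2 \<psi> - {U}"

definition sentence :: "mso \<Rightarrow> bool" where
  "sentence \<phi> \<longleftrightarrow> free1 \<phi> = {} \<and> free2 \<phi> = {}"

primrec sat :: "word \<Rightarrow> (nat \<Rightarrow> nat) \<Rightarrow> (nat \<Rightarrow> nat set) \<Rightarrow> mso \<Rightarrow> bool" where
  "sat w s S (Less x y) \<longleftrightarrow> s x < s y"
| "sat w s S (Eq x y) \<longleftrightarrow> s x = s y"
| "sat w s S (Lab a x) \<longleftrightarrow> w ! s x = a"
| "sat w s S (Mem U x) \<longleftrightarrow> s x \<in> S U"
| "sat w s S (Neg \<psi>) \<longleftrightarrow> \<not> sat w s S \<psi>"
| "sat w s S (Conj \<psi> \<theta>) \<longleftrightarrow> sat w s S \<psi> \<and> sat w s S \<theta>"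
| "sat w s S (Disj \<psi> \<theta>) \<longleftrightarrow> sat w s S \<psi> \<or> sat w s S \<theta>"
| "sat w s S (Ex1 x \<psi>) \<longleftrightarrow> (\<exists>p<length w. sat w (s(x := p)) S \<psi>)"
| "sat w s S (All1 x \<psi>) \<longleftrightarrow> (\<forall>p<length w. sat w (s(x := p)) S \<psi>)"
| "sat w s S (Ex2 U \<psi>) \<longleftrightarrow> (\<exists>A \<subseteq> {..<length w}. sat w s (S(U := A)) \<psi>)"
| "sat w s S (All2 U \<psi>) \<longleftrightarrow> (\<forall>A \<subseteq> {..<length w}. sat w s (S(U := A)) \<psi>)"

text \<open>
  Only used for sentences, where the truth value does not depend on the assignment.
\<close>

definition models :: "word \<Rightarrow> mso \<Rightarrow> bool" where
  "models w \<phi> \<longleftrightarrow> sat w (\<lambda>_. 0) (\<lambda>_. {}) \<phi>"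

definition defines_word :: "mso \<Rightarrow> word \<Rightarrow> bool" where
  "defines_word \<phi> w \<longleftrightarrow>
     w \<noteq> [] \<and> models w \<phi> \<and> (\<forall>v. v \<noteq> [] \<and> models v \<phi> \<longrightarrow> v = w)"

definition MSO :: "nat \<Rightarrow> mso set" where
  "MSO n = {\<phi>. sz \<phi> \<le> n}"

definition Def :: "mso set \<Rightarrow> word set" where
  "Def F = {w. \<exists>\<phi>\<in>F. sentence \<phi> \<and> defines_word \<phi> w}"

text \<open>
  As with any use of \<^const>\<open>Max\<close>, the value is meaningful only when
  \<^term>\<open>Def F\<close> is finite and nonempty.
\<close>

definition DN :: "mso set \<Rightarrow> nat" where
  "DN F = Max (length ` Def F)"

primrec tower :: "nat \<Rightarrow> nat" where
  "tower 0 = 1"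
| "tower (Suc n) = 2 ^ tower n"

definition twr :: "real \<Rightarrow> nat" where
  "twr x = tower (nat \<lceil>x\<rceil>)"

end

theory Submission imports Defs begin

text \<open>
  A word of identical letters is determined by its length, so it suffices to describe a long
  distance by a short formula. If \<open>v = u + d\<close> is definable, then so is \<open>y = x + d * 2 ^ d\<close>:
  guess a set \<open>M\<close> marking the starts of consecutive blocks of length \<open>d\<close> from \<open>x\<close> to \<open>y\<close>
  and a set \<open>C\<close> of bits such that the blocks spell the binary numbers from \<open>0\<close> to \<open>2 ^ d - 1\<close>.
  The formula for \<open>v = u + d\<close> is needed only once, so each exponential costs a constant number
  of symbols. Up to renaming of variables there are only finitely many formulas of a given size,
  so the maximum in \<^const>\<open>DN\<close> is a genuine one.
\<close>

section \<open>Renaming of variables\<close>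

lemma sat_cong:
  assumes "\<And>x. x \<in> free1 \<phi> \<Longrightarrow> s x = s' x" and "\<And>U. U \<in> free2 \<phi> \<Longrightarrow> S U = S' U"
  shows "sat w s S \<phi> \<longleftrightarrow> sat w s' S' \<phi>"
  using assms
proof (induction \<phi> arbitrary: s s' S S')
  case (Conj \<psi> \<theta>)
  have "sat w s S \<psi> \<longleftrightarrow> sat w s' S' \<psi>" "sat w s S \<theta> \<longleftrightarrow> sat w s' S' \<theta>"
    by (rule Conj.IH; use Conj.prems in simp)+
  then show ?case by simp
next
  case (Disj \<psi> \<theta>)
  have "sat w s S \<psi> \<longleftrightarrow> sat w s' S' \<psi>" "sat w s S \<theta> \<longleftrightarrow> sat w s' S' \<theta>"
    by (rule Disj.IH; use Disj.prems in simp)+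
  then show ?case by simp
next
  case (Neg \<psi>)
  have "sat w s S \<psi> \<longleftrightarrow> sat w s' S' \<psi>"
    by (rule Neg.IH; use Neg.prems in simp)
  then show ?case by simp
next
  case (Ex1 x \<psi>)
  have "sat w (s(x := p)) S \<psi> \<longleftrightarrow> sat w (s'(x := p)) S' \<psi>" for p
    by (rule Ex1.IH; use Ex1.prems in simp)
  then show ?case by simp
next
  case (All1 x \<psi>)
  have "sat w (s(x := p)) S \<psi> \<longleftrightarrow> sat w (s'(x := p)) S' \<psi>" for p
    by (rule All1.IH; use All1.prems in simp)
  then show ?case by simp
next
  case (Ex2 U \<psi>)
  have "sat w s (S(U := A)) \<psi> \<longleftrightarrow> sat w s' (S'(U := A)) \<psi>" for A
    by (rule Ex2.IH; use Ex2.prems in simp)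
  then show ?case by simp
next
  case (All2 U \<psi>)
  have "sat w s (S(U := A)) \<psi> \<longleftrightarrow> sat w s' (S'(U := A)) \<psi>" for A
    by (rule All2.IH; use All2.prems in simp)
  then show ?case by simp
qed simp_all

section \<open>Finiteness of the set of words definable in bounded size\<close>

text \<open>Names of both kinds, bound ones included, go into one set, so that a single bound on
  names leaves only finitely many formulas of a given size.\<close>

primrec vars :: "mso \<Rightarrow> nat set" where
  "vars (Less x y) = {x, y}"
| "vars (Eq x y) = {x, y}"
| "vars (Lab a x) = {x}"
| "vars (Mem U x) = {U, x}"
| "vars (Neg \<psi>) = vars \<psi>"
| "vars (Conj \<psi> \<theta>) = vars \<psi> \<union> vars \<theta>"
| "vars (Disj \<psi> \<theta>) = vars \<psi> \<union> vars \<theta>"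
| "vars (Ex1 x \<psi>) = insert x (vars \<psi>)"
| "vars (All1 x \<psi>) = insert x (vars \<psi>)"
| "vars (Ex2 U \<psi>) = insert U (vars \<psi>)"
| "vars (All2 U \<psi>) = insert U (vars \<psi>)"

lemma finite_bounded_formulas: "finite {\<phi>. sz \<phi> \<le> n \<and> vars \<phi> \<subseteq> {..<N}}"
proof (induction n)
  case 0
  have "sz \<phi> > 0" for \<phi> by (induction \<phi>) auto
  then have "{\<phi>. sz \<phi> \<le> 0 \<and> vars \<phi> \<subseteq> {..<N}} = {}" by (simp add: not_le)
  then show ?case by (simp only: finite.emptyI)
next
  case (Suc n)
  define B where "B = {\<phi>. sz \<phi> \<le> n \<and> vars \<phi> \<subseteq> {..<N}}"
  define V where "V = {..<N}"
  have univ: "(UNIV :: letter set) = {L, R}" using letter.exhaust by blast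
  have "{\<phi>. sz \<phi> \<le> Suc n \<and> vars \<phi> \<subseteq> {..<N}} \<subseteq>
     (\<lambda>(x, y). Less x y) ` (V \<times> V) \<union> (\<lambda>(x, y). Eq x y) ` (V \<times> V) \<union>
     (\<lambda>(a, x). Lab a x) ` (UNIV \<times> V) \<union> (\<lambda>(U, x). Mem U x) ` (V \<times> V) \<union>
     Neg ` B \<union> (\<lambda>(\<psi>, \<theta>). Conj \<psi> \<theta>) ` (B \<times> B) \<union> (\<lambda>(\<psi>, \<theta>). Disj \<psi> \<theta>) ` (B \<times> B) \<union>
     (\<lambda>(x, \<psi>). Ex1 x \<psi>) ` (V \<times> B) \<union> (\<lambda>(x, \<psi>). All1 x \<psi>) ` (V \<times> B) \<union>
     (\<lambda>(U, \<psi>). Ex2 U \<psi>) ` (V \<times> B) \<union> (\<lambda>(U, \<psi>). All2 U \<psi>) ` (V \<times> B)"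
    (is "_ \<subseteq> ?rhs")
  proof
    fix \<phi>
    assume "\<phi> \<in> {\<phi>. sz \<phi> \<le> Suc n \<and> vars \<phi> \<subseteq> {..<N}}"
    then show "\<phi> \<in> ?rhs"
      by (cases \<phi>) (auto simp: B_def V_def image_iff)
  qed
  moreover have "finite ?rhs"
    using Suc.IH by (simp add: B_def V_def univ)
  ultimately show ?case by (rule finite_subset)
qed

text \<open>Free names are sent below \<open>m\<close>; a quantifier gives its variable the name
  \<open>m\<close> and its body is treated with \<open>Suc m\<close>. Quantifiers nest less deeply
  than the size of the formula, so all names stay below \<open>m + sz \<phi>\<close>.\<close>

lemma rename_bounded:
  assumes "\<And>x. x \<in> free1 \<phi> \<Longrightarrow> r x < m" and "\<And>U. U \<in> free2 \<phi> \<Longrightarrow> Q U < m"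
  shows "\<exists>\<phi>'. sz \<phi>' = sz \<phi> \<and> vars \<phi>' \<subseteq> {..<m + sz \<phi>} \<and>
           (\<forall>w s S. sat w s S \<phi>' \<longleftrightarrow> sat w (\<lambda>i. s (r i)) (\<lambda>i. S (Q i)) \<phi>)"
  using assms
proof (induction \<phi> arbitrary: r Q m)
  case (Less x y)
  then show ?case by (intro exI[of _ "Less (r x) (r y)"]) (auto simp: less_SucI)
next
  case (Eq x y)
  then show ?case by (intro exI[of _ "Eq (r x) (r y)"]) (auto simp: less_SucI)
next
  case (Lab a x)
  then show ?case by (intro exI[of _ "Lab a (r x)"]) (auto simp: less_SucI)
next
  case (Mem U x)
  then show ?case by (intro exI[of _ "Mem (Q U) (r x)"]) (auto simp: less_SucI)
next
  case (Neg \<psi>)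
  have "\<exists>\<psi>'. sz \<psi>' = sz \<psi> \<and> vars \<psi>' \<subseteq> {..<m + sz \<psi>} \<and>
      (\<forall>w s S. sat w s S \<psi>' \<longleftrightarrow> sat w (\<lambda>i. s (r i)) (\<lambda>i. S (Q i)) \<psi>)"
    by (rule Neg.IH[of r m Q]; use Neg.prems in \<open>auto simp: less_SucI\<close>)
  then obtain \<psi>' where "sz \<psi>' = sz \<psi>" "vars \<psi>' \<subseteq> {..<m + sz \<psi>}"
    "\<And>w s S. sat w s S \<psi>' \<longleftrightarrow> sat w (\<lambda>i. s (r i)) (\<lambda>i. S (Q i)) \<psi>"
    by blast
  then show ?case by (intro exI[of _ "Neg \<psi>'"]) (auto simp: less_SucI)
next
  case (Conj \<psi> \<theta>)
  have "\<exists>\<psi>'. sz \<psi>' = sz \<psi> \<and> vars \<psi>' \<subseteq> {..<m + sz \<psi>} \<and>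
      (\<forall>w s S. sat w s S \<psi>' \<longleftrightarrow> sat w (\<lambda>i. s (r i)) (\<lambda>i. S (Q i)) \<psi>)"
    by (rule Conj.IH(1)[of r m Q]; use Conj.prems in \<open>auto simp: less_SucI\<close>)
  then obtain \<psi>' where "sz \<psi>' = sz \<psi>" "vars \<psi>' \<subseteq> {..<m + sz \<psi>}"
    "\<And>w s S. sat w s S \<psi>' \<longleftrightarrow> sat w (\<lambda>i. s (r i)) (\<lambda>i. S (Q i)) \<psi>"
    by blast
  moreover have "\<exists>\<theta>'. sz \<theta>' = sz \<theta> \<and> vars \<theta>' \<subseteq> {..<m + sz \<theta>} \<and>
      (\<forall>w s S. sat w s S \<theta>' \<longleftrightarrow> sat w (\<lambda>i. s (r i)) (\<lambda>i. S (Q i)) \<theta>)"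
    by (rule Conj.IH(2)[of r m Q]; use Conj.prems in \<open>auto simp: less_SucI\<close>)
  then obtain \<theta>' where "sz \<theta>' = sz \<theta>" "vars \<theta>' \<subseteq> {..<m + sz \<theta>}"
    "\<And>w s S. sat w s S \<theta>' \<longleftrightarrow> sat w (\<lambda>i. s (r i)) (\<lambda>i. S (Q i)) \<theta>"
    by blast
  ultimately show ?case by (intro exI[of _ "Conj \<psi>' \<theta>'"]) fastforce
next
  case (Disj \<psi> \<theta>)
  have "\<exists>\<psi>'. sz \<psi>' = sz \<psi> \<and> vars \<psi>' \<subseteq> {..<m + sz \<psi>} \<and>
      (\<forall>w s S. sat w s S \<psi>' \<longleftrightarrow> sat w (\<lambda>i. s (r i)) (\<lambda>i. S (Q i)) \<psi>)"
    by (rule Disj.IH(1)[of r m Q]; use Disj.prems in \<open>auto simp: less_SucI\<close>)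
  then obtain \<psi>' where "sz \<psi>' = sz \<psi>" "vars \<psi>' \<subseteq> {..<m + sz \<psi>}"
    "\<And>w s S. sat w s S \<psi>' \<longleftrightarrow> sat w (\<lambda>i. s (r i)) (\<lambda>i. S (Q i)) \<psi>"
    by blast
  moreover have "\<exists>\<theta>'. sz \<theta>' = sz \<theta> \<and> vars \<theta>' \<subseteq> {..<m + sz \<theta>} \<and>
      (\<forall>w s S. sat w s S \<theta>' \<longleftrightarrow> sat w (\<lambda>i. s (r i)) (\<lambda>i. S (Q i)) \<theta>)"
    by (rule Disj.IH(2)[of r m Q]; use Disj.prems in \<open>auto simp: less_SucI\<close>)
  then obtain \<theta>' where "sz \<theta>' = sz \<theta>" "vars \<theta>' \<subseteq> {..<m + sz \<theta>}"
    "\<And>w s S. sat w s S \<theta>' \<longleftrightarrow> sat w (\<lambda>i. s (r i)) (\<lambda>i. S (Q i)) \<theta>"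
    by blast
  ultimately show ?case by (intro exI[of _ "Disj \<psi>' \<theta>'"]) fastforce
next
  case (Ex1 x \<psi>)
  have "\<exists>\<psi>'. sz \<psi>' = sz \<psi> \<and> vars \<psi>' \<subseteq> {..<Suc m + sz \<psi>} \<and>
      (\<forall>w s S. sat w s S \<psi>' \<longleftrightarrow> sat w (\<lambda>i. s ((r(x := m)) i)) (\<lambda>i. S (Q i)) \<psi>)"
    by (rule Ex1.IH[of "r(x := m)" "Suc m" Q]; use Ex1.prems in \<open>auto simp: less_SucI\<close>)
  then obtain \<psi>' where \<psi>': "sz \<psi>' = sz \<psi>" "vars \<psi>' \<subseteq> {..<Suc m + sz \<psi>}"
    "\<And>w s S. sat w s S \<psi>' \<longleftrightarrow> sat w (\<lambda>i. s ((r(x := m)) i)) (\<lambda>i. S (Q i)) \<psi>"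
    by blast
  \<comment> \<open>\<open>m\<close> is fresh: \<open>r\<close> sends the free variables of
    \<open>\<psi>\<close> other than \<open>x\<close> below \<open>m\<close>, so only
    \<open>x\<close> sees the new value.\<close>
  have "sat w (\<lambda>i. (s(m := p)) ((r(x := m)) i)) (\<lambda>i. S (Q i)) \<psi> \<longleftrightarrow>
      sat w ((\<lambda>i. s (r i))(x := p)) (\<lambda>i. S (Q i)) \<psi>"
    for w s S p
    by (rule sat_cong; use Ex1.prems(1) in fastforce)
  with \<psi>' show ?case by (intro exI[of _ "Ex1 m \<psi>'"]) auto
next
  case (All1 x \<psi>)
  have "\<exists>\<psi>'. sz \<psi>' = sz \<psi> \<and> vars \<psi>' \<subseteq> {..<Suc m + sz \<psi>} \<and>
      (\<forall>w s S. sat w s S \<psi>' \<longleftrightarrow> sat w (\<lambda>i. s ((r(x := m)) i)) (\<lambda>i. S (Q i)) \<psi>)"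
    by (rule All1.IH[of "r(x := m)" "Suc m" Q]; use All1.prems in \<open>auto simp: less_SucI\<close>)
  then obtain \<psi>' where \<psi>': "sz \<psi>' = sz \<psi>" "vars \<psi>' \<subseteq> {..<Suc m + sz \<psi>}"
    "\<And>w s S. sat w s S \<psi>' \<longleftrightarrow> sat w (\<lambda>i. s ((r(x := m)) i)) (\<lambda>i. S (Q i)) \<psi>"
    by blast
  have "sat w (\<lambda>i. (s(m := p)) ((r(x := m)) i)) (\<lambda>i. S (Q i)) \<psi> \<longleftrightarrow>
      sat w ((\<lambda>i. s (r i))(x := p)) (\<lambda>i. S (Q i)) \<psi>"
    for w s S p
    by (rule sat_cong; use All1.prems(1) in fastforce)
  with \<psi>' show ?case by (intro exI[of _ "All1 m \<psi>'"]) auto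
next
  case (Ex2 U \<psi>)
  have "\<exists>\<psi>'. sz \<psi>' = sz \<psi> \<and> vars \<psi>' \<subseteq> {..<Suc m + sz \<psi>} \<and>
      (\<forall>w s S. sat w s S \<psi>' \<longleftrightarrow> sat w (\<lambda>i. s (r i)) (\<lambda>i. S ((Q(U := m)) i)) \<psi>)"
    by (rule Ex2.IH[of r "Suc m" "Q(U := m)"]; use Ex2.prems in \<open>auto simp: less_SucI\<close>)
  then obtain \<psi>' where \<psi>': "sz \<psi>' = sz \<psi>" "vars \<psi>' \<subseteq> {..<Suc m + sz \<psi>}"
    "\<And>w s S. sat w s S \<psi>' \<longleftrightarrow> sat w (\<lambda>i. s (r i)) (\<lambda>i. S ((Q(U := m)) i)) \<psi>"
    by blast
  have "sat w (\<lambda>i. s (r i)) (\<lambda>i. (S(m := A)) ((Q(U := m)) i)) \<psi> \<longleftrightarrow>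
      sat w (\<lambda>i. s (r i)) ((\<lambda>i. S (Q i))(U := A)) \<psi>"
    for w s S A
    by (rule sat_cong; use Ex2.prems(2) in fastforce)
  with \<psi>' show ?case by (intro exI[of _ "Ex2 m \<psi>'"]) auto
next
  case (All2 U \<psi>)
  have "\<exists>\<psi>'. sz \<psi>' = sz \<psi> \<and> vars \<psi>' \<subseteq> {..<Suc m + sz \<psi>} \<and>
      (\<forall>w s S. sat w s S \<psi>' \<longleftrightarrow> sat w (\<lambda>i. s (r i)) (\<lambda>i. S ((Q(U := m)) i)) \<psi>)"
    by (rule All2.IH[of r "Suc m" "Q(U := m)"]; use All2.prems in \<open>auto simp: less_SucI\<close>)
  then obtain \<psi>' where \<psi>': "sz \<psi>' = sz \<psi>" "vars \<psi>' \<subseteq> {..<Suc m + sz \<psi>}"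
    "\<And>w s S. sat w s S \<psi>' \<longleftrightarrow> sat w (\<lambda>i. s (r i)) (\<lambda>i. S ((Q(U := m)) i)) \<psi>"
    by blast
  have "sat w (\<lambda>i. s (r i)) (\<lambda>i. (S(m := A)) ((Q(U := m)) i)) \<psi> \<longleftrightarrow>
      sat w (\<lambda>i. s (r i)) ((\<lambda>i. S (Q i))(U := A)) \<psi>"
    for w s S A
    by (rule sat_cong; use All2.prems(2) in fastforce)
  with \<psi>' show ?case by (intro exI[of _ "All2 m \<psi>'"]) auto
qed

text \<open>A sentence has no free names to protect, so it can be renamed starting from
  \<open>m = 0\<close>. As a formula defines at most one word, the definable words lie in the image
  of a finite set of formulas.\<close>

lemma finite_Def_MSO: "finite (Def (MSO n))"
proof (rule finite_subset)
  define B where "B = {\<phi>. sz \<phi> \<le> n \<and> vars \<phi> \<subseteq> {..<n}}"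
  show "Def (MSO n) \<subseteq> (\<lambda>\<phi>. THE w. defines_word \<phi> w) ` B"
  proof
    fix w
    assume "w \<in> Def (MSO n)"
    then obtain \<phi> where \<phi>: "sz \<phi> \<le> n" "sentence \<phi>" "defines_word \<phi> w"
      by (auto simp: Def_def MSO_def)
    obtain \<phi>' where \<phi>': "sz \<phi>' = sz \<phi>" "vars \<phi>' \<subseteq> {..<sz \<phi>}"
      "\<And>v s S. sat v s S \<phi>' \<longleftrightarrow> sat v s S \<phi>"
      using rename_bounded[of \<phi> id 0 id] \<phi>(2) by (auto simp: sentence_def)
    have "defines_word \<phi>' w"
      using \<phi>(3) \<phi>'(3) by (simp add: defines_word_def models_def)
    moreover from this have "(THE v. defines_word \<phi>' v) = w"
      by (intro the_equality) (auto simp: defines_word_def)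
    moreover have "\<phi>' \<in> B" using \<phi>(1) \<phi>'(1,2) by (auto simp: B_def)
    ultimately show "w \<in> (\<lambda>\<phi>. THE w. defines_word \<phi> w) ` B" by force
  qed
  show "finite ((\<lambda>\<phi>. THE w. defines_word \<phi> w) ` B)"
    by (simp add: B_def finite_bounded_formulas)
qed

lemma length_le_DN:
  assumes "sz \<phi> \<le> n" "sentence \<phi>" "defines_word \<phi> w"
  shows "length w \<le> DN (MSO n)"
  unfolding DN_def
  using assms by (intro Max_ge finite_imageI finite_Def_MSO) (auto simp: Def_def MSO_def)

section \<open>Binary counters\<close>

text \<open>The carry reaches bit \<open>j\<close>, and flips it, exactly if all lower bits are 1.
  This form of the increment compares single bits and can be written as a formula.\<close>

lemma bit_Suc_nat_iff:
  fixes i :: nat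
  shows "bit (Suc i) j \<longleftrightarrow> (bit i j \<longleftrightarrow> (\<exists>l<j. \<not> bit i l))"
proof (induction j arbitrary: i)
  case 0
  then show ?case by (simp add: bit_0)
next
  case (Suc j)
  have ex: "(\<exists>l<Suc j. \<not> bit i l) \<longleftrightarrow> even i \<or> (\<exists>l<j. \<not> bit (i div 2) l)"
    unfolding less_Suc_eq_0_disj by (auto simp: bit_0 bit_Suc)
  show ?case
  proof (cases "even i")
    case True
    then show ?thesis using ex by (simp add: bit_Suc)
  next
    case False
    \<comment> \<open>For odd \<open>i\<close> the carry is passed on to the half of
      \<open>i\<close>, where the induction hypothesis applies.\<close>
    then have "Suc i div 2 = Suc (i div 2)" by presburger
    then show ?thesis using ex Suc.IH[of "i div 2"] False by (simp add: bit_Suc)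
  qed
qed

text \<open>The test by which a counter recognises its final value.\<close>

lemma all_bits_iff:
  fixes i :: nat
  assumes "i < 2 ^ d"
  shows "(\<forall>j<d. bit i j) \<longleftrightarrow> i = 2 ^ d - 1"
proof
  assume all: "\<forall>j<d. bit i j"
  have "take_bit d i = i" using assms by (simp add: take_bit_nat_eq_self)
  moreover have "take_bit d i = mask d"
    by (rule bit_eqI) (use all in \<open>auto simp: bit_take_bit_iff bit_mask_iff\<close>)
  ultimately show "i = 2 ^ d - 1" by (simp add: mask_eq_exp_minus_1)
next
  assume "i = 2 ^ d - 1"
  then have "i = mask d" by (simp add: mask_eq_exp_minus_1)
  then show "\<forall>j<d. bit i j" by (simp add: bit_mask_iff)
qed

text \<open>
  \<open>e\<close> is the start of the last block. In the clause for incrementing, \<open>z\<close> ranges over the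
  less significant bits of the block containing \<open>u\<close>: the least significant bit comes first.
\<close>

definition counter_step :: "nat \<Rightarrow> nat \<Rightarrow> nat \<Rightarrow> nat set \<Rightarrow> nat set \<Rightarrow> nat \<Rightarrow> bool" where
  "counter_step d x e M C u \<longleftrightarrow>
     (u \<in> M \<longleftrightarrow> u + d \<in> M) \<and>
     (u = x \<longrightarrow> (\<forall>z. u \<le> z \<and> z < u + d \<longrightarrow> z \<notin> C \<and> (z \<in> M \<longrightarrow> z = u))) \<and>
     (u < e \<longrightarrow> ((u + d \<in> C) \<longleftrightarrow> ((u \<in> C) \<longleftrightarrow>
       (\<exists>z. z < u \<and> z \<notin> C \<and> \<not> (\<exists>t. z < t \<and> t \<le> u \<and> t \<in> M))))) \<and>
     (u \<in> M \<longrightarrow> (u = e \<longleftrightarrow> (\<forall>z. u \<le> z \<and> z < u + d \<longrightarrow> z \<in> C)))"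

text \<open>The number \<open>d\<close> enters only through the step from a position to the one
  \<open>d\<close> further on. Since the clauses are imposed at every \<open>u\<close>, block start
  or not, one description of this step serves all bits.\<close>

definition counter :: "nat \<Rightarrow> nat \<Rightarrow> nat \<Rightarrow> nat \<Rightarrow> nat set \<Rightarrow> nat set \<Rightarrow> bool" where
  "counter d x y e M C \<longleftrightarrow> x \<le> e \<and> x \<in> M \<and> e \<in> M \<and> y = e + d \<and>
     (\<forall>u. x \<le> u \<and> u \<le> e \<longrightarrow> counter_step d x e M C u)"

text \<open>Expresses "a lower bit of the same block" without naming the start of the block: for
  \<open>z\<close> before \<open>a\<close>, the marked point \<open>a\<close> itself would lie
  between \<open>z\<close> and the current position.\<close>

lemma same_block_iff:
  fixes a :: nat
  assumes "\<And>j. j < d \<Longrightarrow> a + j \<in> M \<longleftrightarrow> j = 0" and "j < d"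
  shows "z < a + j \<and> \<not> (\<exists>t. z < t \<and> t \<le> a + j \<and> t \<in> M) \<longleftrightarrow> (\<exists>l<j. z = a + l)"
proof
  assume z: "z < a + j \<and> \<not> (\<exists>t. z < t \<and> t \<le> a + j \<and> t \<in> M)"
  have "a \<in> M" using assms(1)[of 0] assms(2) by simp
  with z have "a \<le> z" by (metis le_add1 not_le)
  with z show "\<exists>l<j. z = a + l"
    by (intro exI[of _ "z - a"]) linarith
next
  assume "\<exists>l<j. z = a + l"
  then obtain l where l: "l < j" "z = a + l" by blast
  have "t \<notin> M" if "z < t" "t \<le> a + j" for t
    using assms(1)[of "t - a"] assms(2) l that by auto
  with l show "z < a + j \<and> \<not> (\<exists>t. z < t \<and> t \<le> a + j \<and> t \<in> M)" by auto
qed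

lemma all_block_iff:
  fixes a d :: nat
  shows "(\<forall>z. a \<le> z \<and> z < a + d \<longrightarrow> P z) \<longleftrightarrow> (\<forall>j<d. P (a + j))"
  by (metis add_less_cancel_left le_add1 nat_le_iff_add)

text \<open>By induction, the \<open>i\<close>-th block is marked only at its start and spells
  \<open>i\<close> in binary. Then \<open>e\<close> starts a block of ones, which is the block
  number \<open>2 ^ d - 1\<close>.\<close>

lemma counter_imp_eq:
  assumes c: "counter d x y e M C" and d: "d > 0"
  shows "y = x + d * 2 ^ d"
proof -
  have xe: "x \<le> e" and x: "x \<in> M" and e: "e \<in> M" and y: "y = e + d"
    using c by (auto simp: counter_def)
  have M: "u \<in> M \<longleftrightarrow> u + d \<in> M" if "x \<le> u" "u \<le> e" for u
    using c that by (simp add: counter_def counter_step_def)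
  have step_x: "counter_step d x e M C x" using c xe by (simp add: counter_def)
  have init: "j < d \<Longrightarrow> x + j \<notin> C \<and> (x + j \<in> M \<longrightarrow> j = 0)" for j
    using step_x by (simp add: counter_step_def all_block_iff)
  have incr: "(u + d \<in> C) \<longleftrightarrow> ((u \<in> C) \<longleftrightarrow>
       (\<exists>z. z < u \<and> z \<notin> C \<and> \<not> (\<exists>t. z < t \<and> t \<le> u \<and> t \<in> M)))" if "x \<le> u" "u < e" for u
    using c that unfolding counter_def counter_step_def by (meson less_imp_le)
  have last: "u = e \<longleftrightarrow> (\<forall>j<d. u + j \<in> C)" if "x \<le> u" "u \<le> e" "u \<in> M" for u
    using c that by (simp add: counter_def counter_step_def all_block_iff)
  have block: "i < 2 ^ d \<and> (\<forall>j<d. (x + d * i + j \<in> M \<longleftrightarrow> j = 0) \<and> (x + d * i + j \<in> C \<longleftrightarrow> bit i j))"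
    if "x + d * i \<le> e" for i
    using that
  proof (induction i)
    case 0
    then show ?case using init x by auto
  next
    case (Suc i)
    let ?a = "x + d * i"
    have a: "?a + d \<le> e" and a': "x + d * Suc i = ?a + d" using Suc.prems by auto
    then have IH: "i < 2 ^ d" "\<And>j. j < d \<Longrightarrow> ?a + j \<in> M \<longleftrightarrow> j = 0"
      "\<And>j. j < d \<Longrightarrow> ?a + j \<in> C \<longleftrightarrow> bit i j"
      using Suc.IH by auto
    \<comment> \<open>A block before \<open>e\<close> is not all ones, so \<open>Suc i\<close> still
      fits into \<open>d\<close> bits.\<close>
    have "?a \<noteq> e" using a d by linarith
    moreover have "?a \<in> M" using IH(2)[of 0] d by simp
    ultimately have "\<not> (\<forall>j<d. ?a + j \<in> C)" using last[of ?a] a by simp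
    then have "\<not> (\<forall>j<d. bit i j)" using IH(3) by blast
    then have "i \<noteq> 2 ^ d - 1" using all_bits_iff[OF IH(1)] by blast
    then have "Suc i < 2 ^ d" using IH(1) by linarith
    moreover have "(?a + d + j \<in> M \<longleftrightarrow> j = 0) \<and> (?a + d + j \<in> C \<longleftrightarrow> bit (Suc i) j)" if j: "j < d" for j
    proof
      have sw: "?a + d + j = ?a + j + d" by simp
      show "?a + d + j \<in> M \<longleftrightarrow> j = 0"
        unfolding sw using M[of "?a + j"] IH(2)[OF j] a j by simp
      have "(\<exists>z. z < ?a + j \<and> z \<notin> C \<and> \<not> (\<exists>t. z < t \<and> t \<le> ?a + j \<and> t \<in> M)) \<longleftrightarrow>
          (\<exists>l<j. ?a + l \<notin> C)"
        using same_block_iff[of d ?a M, OF IH(2) j] by metis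
      also have "\<dots> \<longleftrightarrow> (\<exists>l<j. \<not> bit i l)" using IH(3) j by (metis less_trans)
      finally show "?a + d + j \<in> C \<longleftrightarrow> bit (Suc i) j"
        unfolding sw using incr[of "?a + j"] IH(3)[OF j] a j by (simp add: bit_Suc_nat_iff)
    qed
    ultimately show ?case unfolding a' by blast
  qed
  define i where "i = (e - x) div d"
  define j where "j = (e - x) mod d"
  have eq: "e = x + d * i + j" and j: "j < d"
    using xe d by (simp_all add: i_def j_def)
  \<comment> \<open>\<open>e\<close> is marked, and a block is marked only at its start.\<close>
  have "j = 0" using block[of i] eq e j by auto
  then have eq: "e = x + d * i" using eq by simp
  have "\<forall>j<d. bit i j" using block[of i] last[OF xe order_refl e] eq by auto
  then have "i = 2 ^ d - 1" using all_bits_iff block[of i] eq by auto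
  then have "y = x + d * (2 ^ d - 1) + d * 1" using y eq by simp
  also have "\<dots> = x + d * (2 ^ d - 1 + 1)" by (simp only: distrib_left add.assoc)
  finally show ?thesis by simp
qed

text \<open>The intended marking and bits satisfy all clauses. The bounds on \<open>e\<close>,
  \<open>M\<close> and \<open>C\<close> are what lets them be chosen inside any word that has the
  end point as a position.\<close>

lemma counter_exists:
  assumes d: "d > 0"
  shows "\<exists>e<x + d * 2 ^ d. \<exists>M C. M \<subseteq> {..x + d * 2 ^ d} \<and> C \<subseteq> {..x + d * 2 ^ d} \<and>
           counter d x (x + d * 2 ^ d) e M C"
proof -
  define y where "y = x + d * 2 ^ d"
  define e where "e = x + d * (2 ^ d - 1)"
  \<comment> \<open>The range goes up to \<open>y\<close> rather than \<open>e\<close>: the marking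
    clause at \<open>u = e\<close> requires \<open>y\<close> to be marked.\<close>
  define M where "M = {p. x \<le> p \<and> p \<le> y \<and> (p - x) mod d = 0}"
  define C where "C = {p. x \<le> p \<and> p \<le> y \<and> bit ((p - x) div d) ((p - x) mod d)}"
  have "d * 2 ^ d = d * (2 ^ d - 1 + 1)" by simp
  then have y: "y = e + d" unfolding y_def e_def by (simp only: distrib_left add.assoc mult_1_right)
  have inM: "x + d * i + j \<in> M \<longleftrightarrow> j = 0" if "j < d" "x + d * i + j \<le> y" for i j
    using that by (simp add: M_def add.assoc)
  have inC: "x + d * i + j \<in> C \<longleftrightarrow> bit i j" if "j < d" "x + d * i + j \<le> y" for i j
    using that by (simp add: C_def add.assoc)
  have clauses: "counter_step d x e M C u"
    if "x \<le> u" "u \<le> e" for u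
  proof -
    define i where "i = (u - x) div d"
    define j where "j = (u - x) mod d"
    have u: "u = x + d * i + j" and j: "j < d"
      using that d by (simp_all add: i_def j_def)
    have ud: "u + d = x + d * Suc i + j" using u by simp
    have uy: "u + d \<le> y" using that y by simp
    have inM': "x + d * i + l \<in> M \<longleftrightarrow> l = 0" if "l < d" for l
      using inM[OF that, of i] uy that u by simp
    have inC': "x + d * i + l \<in> C \<longleftrightarrow> bit i l" if "l < d" for l
      using inC[OF that, of i] uy that u by simp
    \<comment> \<open>A position up to \<open>e\<close> lies in a block whose number has at most
      \<open>d\<close> bits, as \<open>all_bits_iff\<close> demands.\<close>
    have "d * i + j \<le> d * (2 ^ d - 1)" using u that by (simp add: e_def)
    then have "d * i \<le> d * (2 ^ d - 1)" by (rule add_leD1)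
    then have "i \<le> 2 ^ d - 1" unfolding nat_mult_le_cancel1[OF d] .
    then have i: "i < 2 ^ d" by (simp add: le_less_trans)
    have "u \<in> M \<longleftrightarrow> u + d \<in> M"
      using inM'[OF j] inM[OF j, of "Suc i"] uy unfolding u[symmetric] ud[symmetric] by simp
    moreover have "\<forall>z. u \<le> z \<and> z < u + d \<longrightarrow> z \<notin> C \<and> (z \<in> M \<longrightarrow> z = u)" if "u = x"
    proof -
      have "i = 0" "j = 0" using that u d by auto
      then show ?thesis unfolding all_block_iff using inM' inC' that by simp
    qed
    moreover have "(u + d \<in> C) \<longleftrightarrow> ((u \<in> C) \<longleftrightarrow>
          (\<exists>z. z < u \<and> z \<notin> C \<and> \<not> (\<exists>t. z < t \<and> t \<le> u \<and> t \<in> M)))"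
    proof -
      have "(\<exists>z. z < u \<and> z \<notin> C \<and> \<not> (\<exists>t. z < t \<and> t \<le> u \<and> t \<in> M)) \<longleftrightarrow>
          (\<exists>l<j. x + d * i + l \<notin> C)"
        using same_block_iff[of d "x + d * i" M, OF inM' j] unfolding u[symmetric] by metis
      also have "\<dots> \<longleftrightarrow> (\<exists>l<j. \<not> bit i l)" using inC' j by (metis less_trans)
      finally show ?thesis
        using inC'[OF j] inC[OF j, of "Suc i"] uy unfolding u[symmetric] ud[symmetric]
        by (simp add: bit_Suc_nat_iff)
    qed
    moreover have "u = e \<longleftrightarrow> (\<forall>z. u \<le> z \<and> z < u + d \<longrightarrow> z \<in> C)" if "u \<in> M"
    proof -
      have "j = 0" using that inM'[OF j] u by simp
      then have "(\<forall>z. u \<le> z \<and> z < u + d \<longrightarrow> z \<in> C) \<longleftrightarrow> (\<forall>l<d. bit i l)"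
        unfolding all_block_iff using inC' u by simp
      also have "\<dots> \<longleftrightarrow> u = e"
        using all_bits_iff[OF i] u \<open>j = 0\<close> d by (simp add: e_def)
      finally show ?thesis by simp
    qed
    ultimately show ?thesis unfolding counter_step_def by blast
  qed
  have "x \<le> e" "x \<in> M" "e \<in> M" using y by (auto simp: M_def e_def)
  with clauses y have "counter d x y e M C" unfolding counter_def by blast
  moreover have "e < y" "M \<subseteq> {..y}" "C \<subseteq> {..y}" using y d by (auto simp: M_def C_def)
  ultimately show ?thesis unfolding y_def by blast
qed

section \<open>Defining a tower of distances\<close>

text \<open>A counter with blocks of length \<open>d\<close> has \<open>2 ^ d\<close> of them, which
  gives the recursion.\<close>

primrec dist_val :: "nat \<Rightarrow> nat" where
  "dist_val 0 = 1"
| "dist_val (Suc k) = dist_val k * 2 ^ dist_val k"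

lemma dist_val_pos: "dist_val k > 0"
  by (induction k) auto

lemma tower_le_dist_val: "tower k \<le> dist_val k"
proof (induction k)
  case (Suc k)
  then have "2 ^ tower k \<le> (2::nat) ^ dist_val k" by simp
  also have "\<dots> \<le> dist_val k * 2 ^ dist_val k" using dist_val_pos[of k] by simp
  finally show ?case by simp
qed simp

definition Le :: "nat \<Rightarrow> nat \<Rightarrow> mso" where "Le x y = Neg (Less y x)"
definition Imp :: "mso \<Rightarrow> mso \<Rightarrow> mso" where "Imp \<phi> \<psi> = Disj (Neg \<phi>) \<psi>"
definition Iff :: "mso \<Rightarrow> mso \<Rightarrow> mso" where "Iff \<phi> \<psi> = Conj (Imp \<phi> \<psi>) (Imp \<psi> \<phi>)"

lemma sat_Le [simp]: "sat w s S (Le x y) \<longleftrightarrow> s x \<le> s y"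
  by (auto simp: Le_def)

lemma sat_Imp [simp]: "sat w s S (Imp \<phi> \<psi>) \<longleftrightarrow> (sat w s S \<phi> \<longrightarrow> sat w s S \<psi>)"
  by (simp add: Imp_def)

lemma sat_Iff [simp]: "sat w s S (Iff \<phi> \<psi>) \<longleftrightarrow> (sat w s S \<phi> \<longleftrightarrow> sat w s S \<psi>)"
  by (auto simp: Iff_def)

text \<open>
  Set variables \<open>0\<close> and \<open>1\<close> stand for \<open>M\<close> and \<open>C\<close> of \<^const>\<open>counter\<close>. Since the formula of the
  preceding level has no free set variable, they can be reused at every level.
\<close>

definition counter_form :: "mso \<Rightarrow> nat \<Rightarrow> nat \<Rightarrow> nat \<Rightarrow> nat \<Rightarrow> nat \<Rightarrow> nat \<Rightarrow> nat \<Rightarrow> mso" where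
  "counter_form \<delta> x y e u v z t =
     Ex1 e (Ex2 0 (Ex2 1 (Conj (Conj (Le x e) (Conj (Mem 0 x) (Mem 0 e)))
       (All1 u (Imp (Conj (Le x u) (Le u e)) (Ex1 v (Conj \<delta>
         (Conj (Imp (Eq u e) (Eq v y))
         (Conj (Iff (Mem 0 u) (Mem 0 v))
         (Conj (Imp (Eq u x) (All1 z (Imp (Conj (Le u z) (Less z v))
                  (Conj (Neg (Mem 1 z)) (Imp (Mem 0 z) (Eq z u))))))
         (Conj (Imp (Less u e) (Iff (Mem 1 v) (Iff (Mem 1 u)
                  (Ex1 z (Conj (Less z u) (Conj (Neg (Mem 1 z))
                     (Neg (Ex1 t (Conj (Less z t) (Conj (Le t u) (Mem 0 t)))))))))))
           (Imp (Mem 0 u) (Iff (Eq u e)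
                  (All1 z (Imp (Conj (Le u z) (Less z v)) (Mem 1 z))))))))))))))))"

text \<open>The formula is \<open>counter\<close> with all quantifiers restricted to positions of
  the word. The restriction loses nothing, because the whole counter ends at the position
  \<open>s y\<close>.\<close>

lemma sat_counter_form:
  assumes \<delta>: "\<And>s S. s u < length w \<Longrightarrow> s v < length w \<Longrightarrow> sat w s S \<delta> \<longleftrightarrow> s v = s u + d"
    and dist: "distinct [x, y, e, u, v, z, t]"
    and xy: "s x < length w" "s y < length w" and d: "d > 0"
  shows "sat w s S (counter_form \<delta> x y e u v z t) \<longleftrightarrow> s y = s x + d * 2 ^ d"
proof -
  define n where "n = length w"
  \<comment> \<open>Here \<open>v\<close> stands for \<open>u + d\<close>. The clause for
    \<open>u = e\<close> encodes \<open>y = e + d\<close>, so that no second copy of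
    \<open>\<delta>\<close> is needed.\<close>
  define body where "body = (\<lambda>e M C u v.
     (u = e \<longrightarrow> v = s y) \<and> (u \<in> M \<longleftrightarrow> v \<in> M) \<and>
     (u = s x \<longrightarrow> (\<forall>z<n. u \<le> z \<and> z < v \<longrightarrow> z \<notin> C \<and> (z \<in> M \<longrightarrow> z = u))) \<and>
     (u < e \<longrightarrow> (v \<in> C \<longleftrightarrow> (u \<in> C \<longleftrightarrow>
        (\<exists>z<n. z < u \<and> z \<notin> C \<and> \<not> (\<exists>t<n. z < t \<and> t \<le> u \<and> t \<in> M))))) \<and>
     (u \<in> M \<longrightarrow> (u = e \<longleftrightarrow> (\<forall>z<n. u \<le> z \<and> z < v \<longrightarrow> z \<in> C))))"
  have "sat w s S (counter_form \<delta> x y e u v z t) \<longleftrightarrow>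
     (\<exists>e<n. \<exists>M\<subseteq>{..<n}. \<exists>C\<subseteq>{..<n}. s x \<le> e \<and> s x \<in> M \<and> e \<in> M \<and>
       (\<forall>u<n. s x \<le> u \<and> u \<le> e \<longrightarrow> (\<exists>v<n. v = u + d \<and> body e M C u v)))"
    unfolding counter_form_def body_def n_def
    using dist by (simp add: \<delta> not_less cong: conj_cong)
  also have "\<dots> \<longleftrightarrow> (\<exists>e<n. \<exists>M\<subseteq>{..<n}. \<exists>C\<subseteq>{..<n}. counter d (s x) (s y) e M C)"
  proof -
    have "s x \<le> e \<and> s x \<in> M \<and> e \<in> M \<and>
        (\<forall>u<n. s x \<le> u \<and> u \<le> e \<longrightarrow> (\<exists>v<n. v = u + d \<and> body e M C u v)) \<longleftrightarrow>
        counter d (s x) (s y) e M C" (is "?l \<longleftrightarrow> _") if "e < n" for e M C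
    proof -
      have body: "body e M C u (u + d) \<longleftrightarrow> (u = e \<longrightarrow> u + d = s y) \<and> counter_step d (s x) e M C u"
        if "u + d < n" for u
      proof -
        \<comment> \<open>As \<open>u + d\<close> is a position, so is everything below it, and the
          bounds by \<open>n\<close> may be dropped.\<close>
        have up: "(\<forall>z<n. u \<le> z \<and> z < u + d \<longrightarrow> P z) \<longleftrightarrow> (\<forall>z. u \<le> z \<and> z < u + d \<longrightarrow> P z)" for P
          using that by (meson less_trans)
        have down: "(\<exists>z<n. z < u \<and> P z) \<longleftrightarrow> (\<exists>z. z < u \<and> P z)"
          "(\<exists>t<n. z < t \<and> t \<le> u \<and> P t) \<longleftrightarrow> (\<exists>t. z < t \<and> t \<le> u \<and> P t)" for P z
          using that by (metis add_lessD1 le_less_trans less_imp_le)+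
        show ?thesis unfolding body_def counter_step_def up down by blast
      qed
      \<comment> \<open>The case \<open>u = e\<close> yields \<open>e + d = s y\<close>; conversely,
        this equation puts \<open>u + d\<close> below \<open>n\<close> for all
        \<open>u \<le> e\<close>.\<close>
      have "?l \<longleftrightarrow> s x \<le> e \<and> s x \<in> M \<and> e \<in> M \<and>
        (\<forall>u. s x \<le> u \<and> u \<le> e \<longrightarrow> u + d < n \<and> (u = e \<longrightarrow> u + d = s y) \<and> counter_step d (s x) e M C u)"
        using body that by (metis le_less_trans)
      also have "\<dots> \<longleftrightarrow> counter d (s x) (s y) e M C"
        unfolding counter_def using xy(2) by (auto simp: n_def)
      finally show ?thesis .
    qed
    then show ?thesis by meson
  qed
  also have "\<dots> \<longleftrightarrow> s y = s x + d * 2 ^ d"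
  proof
    assume eq: "s y = s x + d * 2 ^ d"
    then have "{..s x + d * 2 ^ d} \<subseteq> {..<n}" "s x + d * 2 ^ d < n" using xy by (auto simp: n_def)
    then show "\<exists>e<n. \<exists>M\<subseteq>{..<n}. \<exists>C\<subseteq>{..<n}. counter d (s x) (s y) e M C"
      using counter_exists[OF d, of "s x"] unfolding eq by (meson less_trans subset_trans)
  qed (use counter_imp_eq d in blast)
  finally show ?thesis .
qed

text \<open>New names exceed \<open>x + y\<close> and therefore differ from \<open>x\<close> and
  \<open>y\<close>. The preceding level occurs once, with the names that play \<open>u\<close> and
  \<open>v\<close> in \<open>counter_form\<close>.\<close>

primrec dist_form :: "nat \<Rightarrow> nat \<Rightarrow> nat \<Rightarrow> mso" where
  "dist_form 0 x y = Conj (Less x y)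
     (Neg (Ex1 (x + y + 1) (Conj (Less x (x + y + 1)) (Less (x + y + 1) y))))"
| "dist_form (Suc k) x y = (let n = x + y in
     counter_form (dist_form k (n + 1) (n + 2)) x y (n + 3) (n + 1) (n + 2) (n + 4) (n + 5))"

lemma sat_dist_form:
  assumes "x \<noteq> y" "s x < length w" "s y < length w"
  shows "sat w s S (dist_form k x y) \<longleftrightarrow> s y = s x + dist_val k"
  using assms
proof (induction k arbitrary: x y s S)
  case 0
  show ?case
  proof
    assume "sat w s S (dist_form 0 x y)"
    then have "s x < s y" and *: "\<not> (\<exists>p<length w. s x < p \<and> p < s y)" by auto
    moreover have "\<not> s x + 1 < s y" using * 0 by (metis less_add_one less_trans)
    ultimately show "s y = s x + dist_val 0" by simp
  qed (use 0 in auto)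
next
  case (Suc k)
  show ?case
    unfolding dist_form.simps dist_val.simps Let_def
    by (rule sat_counter_form) (use Suc dist_val_pos in auto)
qed

lemma free_dist_form:
  assumes "x \<noteq> y"
  shows "free1 (dist_form k x y) = {x, y} \<and> free2 (dist_form k x y) = {}"
  using assms
proof (induction k arbitrary: x y)
  case (Suc k)
  then show ?case by (auto simp: Let_def counter_form_def Le_def Imp_def Iff_def)
qed auto

text \<open>As \<open>counter_form\<close> contains \<open>\<delta>\<close> once, a level adds a
  constant to the size instead of multiplying it.\<close>

lemma sz_dist_form: "sz (dist_form k x y) = 7 + 160 * k"
  by (induction k arbitrary: x y) (simp_all add: Let_def counter_form_def Le_def Imp_def Iff_def)

section \<open>The sentence defining a long word\<close>

text \<open>Variables 0 and 1 are forced to be the first and the last position, so their distance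
  fixes the length, while the first conjunct fixes the letters.\<close>

definition tower_sentence :: "nat \<Rightarrow> mso" where
  "tower_sentence k = Conj (All1 0 (Lab L 0))
     (Ex1 0 (Ex1 1 (Conj (dist_form k 0 1) (All1 2 (Conj (Le 0 2) (Le 2 1))))))"

lemma sentence_tower_sentence: "sentence (tower_sentence k)"
  using free_dist_form[of 0 1 k] by (auto simp: tower_sentence_def sentence_def Le_def)

text \<open>The length is one more than the distance between the first and the last position, whence
  the \<open>Suc\<close>.\<close>

lemma models_tower_sentence:
  assumes "w \<noteq> []"
  shows "models w (tower_sentence k) \<longleftrightarrow> w = replicate (Suc (dist_val k)) L"
proof -
  have "models w (tower_sentence k) \<longleftrightarrow> (\<forall>p<length w. w ! p = L) \<and>
     (\<exists>p<length w. \<exists>q<length w. q = p + dist_val k \<and> (\<forall>r<length w. p \<le> r \<and> r \<le> q))"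
    by (simp add: models_def tower_sentence_def sat_dist_form not_less cong: conj_cong)
  also have "(\<exists>p<length w. \<exists>q<length w. q = p + dist_val k \<and> (\<forall>r<length w. p \<le> r \<and> r \<le> q))
     \<longleftrightarrow> length w = Suc (dist_val k)" (is "?l \<longleftrightarrow> ?r")
  proof
    assume ?l
    then obtain p where p: "p + dist_val k < length w"
      "\<And>r. r < length w \<Longrightarrow> p \<le> r \<and> r \<le> p + dist_val k" by blast
    have "p = 0" using p(2)[of 0] assms by simp
    moreover have "length w - 1 \<le> p + dist_val k" using p(2)[of "length w - 1"] assms by simp
    ultimately show ?r using p(1) by simp
  qed auto
  finally show ?thesis
    by (auto simp: list_eq_iff_nth_eq simp del: replicate_Suc)
qed

lemma tower_le_DN:
  assumes "sz (tower_sentence k) \<le> n"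
  shows "tower k \<le> DN (MSO n)"
proof -
  have "defines_word (tower_sentence k) (replicate (Suc (dist_val k)) L)"
    using models_tower_sentence by (auto simp: defines_word_def)
  then have "length (replicate (Suc (dist_val k)) L) \<le> DN (MSO n)"
    using assms sentence_tower_sentence length_le_DN by blast
  then show ?thesis using tower_le_dist_val[of k] by simp
qed

theorem theorem4:
  "\<exists>c::nat. c > 0 \<and> infinite {n::nat. DN (MSO n) \<ge> twr (sqrt (real n / real c))}"
proof (intro exI[of _ 200] conjI)
  \<comment> \<open>These sizes make the square root an integer, so the ceiling in
    \<open>twr\<close> has no effect.\<close>
  have "200 * Suc k ^ 2 \<in> {n. DN (MSO n) \<ge> twr (sqrt (real n / real (200::nat)))}" for k
  proof -
    have "sqrt (real (200 * Suc k ^ 2) / real (200::nat)) = real (Suc k)"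
      by (simp add: real_sqrt_unique)
    then have "twr (sqrt (real (200 * Suc k ^ 2) / real (200::nat))) = tower (Suc k)"
      unfolding twr_def by (simp only: ceiling_of_nat nat_int)
    \<comment> \<open>The size is \<open>19 + 160 * Suc k\<close>, which is at most
      \<open>200 * Suc k\<close>; this is where 200 comes from.\<close>
    moreover have "sz (tower_sentence (Suc k)) \<le> 200 * Suc k ^ 2"
      by (simp add: tower_sentence_def sz_dist_form power2_eq_square Le_def del: dist_form.simps)
    ultimately show ?thesis unfolding mem_Collect_eq using tower_le_DN by metis
  qed
  then have "range (\<lambda>k. 200 * Suc k ^ 2) \<subseteq> {n. DN (MSO n) \<ge> twr (sqrt (real n / real (200::nat)))}"
    by blast
  moreover have "inj (\<lambda>k. 200 * Suc k ^ 2)"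
    by (rule injI) simp
  then have "infinite (range (\<lambda>k. 200 * Suc k ^ 2))"
    using finite_imageD by blast
  ultimately show "infinite {n::nat. DN (MSO n) \<ge> twr (sqrt (real n / real (200::nat)))}"
    using infinite_super by blast
qed simp

end
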